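(* Let $\Omega=(0,1)\times(0,1)$ with coordinates $(s,r)$, and let $K_\parallel,K_\perp\ge 0$, $\gamma\ge0$, $Q_\perp>0$, $\nu>0$, $\Delta t>0$ be constants. Let $(T^n)_{n\in\mathbb{N}}$ be given by the directional splitting IMEX scheme described in the context, starting from an initial datum $T^0$. Assume that the viscosity $\nu$ is such that, for any $r\in(0,1)$, $$K_\parallel\|T^n(\cdot,r)\|_\infty^{5/2}\le\nu,\qquad\forall n\in\mathbb{N}.$$ Then the numerical solution satisfies, for all $n\in\mathbb{N}$, $$ \begin{aligned} \frac12\int_\Omega(T^{n+1})^2\,dr\,ds+\frac{\nu\Delta t}{2}\int_\Omega|\partial_sT^{n+1}|^2\,dr\,ds\ \le\ &\frac12\int_\Omega(T^0)^2\,dr\,ds+\frac{\nu\Delta t}{2}\int_\Omega|\partial_sT^0|^2\,dr\,ds\\ &-K_\perp\Delta t\sum_{k=1}^{n+1}\left[\int_\Omega|\partial_rT^k|^2\,dr\,ds-Q_\perp\int_0^1T^k(s,0)\,ds\right]. \end{aligned} $$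
   Context: The scheme (discrete in time, continuous in space) computes $T^{n+1}$ from $T^n$ in two steps. **Step 1 (direction $s$).** $T^\star$ solves $$\frac{T^\star-T^n}{\Delta t}-\partial_s\left(\left(K_\parallel|T^n|^{5/2}-\nu\right)\partial_sT^n\right)-\nu\,\partial_{ss}^2T^\star=0,\quad(s,r)\in\Omega.$$ Write $\Phi(s,r)=\left(K_\parallel|T^n(s,r)|^{5/2}-\nu\right)\partial_sT^n(s,r)+\nu\,\partial_sT^\star(s,r)$ for the total flux. The boundary conditions are: for $r\in(1/2,1)$, $$\Phi(0,r)=\gamma T^\star(0,r),\qquad\Phi(1,r)=-\gamma T^\star(1,r);$$ for $r\in(0,1/2)$, periodic conditions $$T^\star(0,r)=T^\star(1,r),\qquad\Phi(0,r)=\Phi(1,r).$$ **Step 2 (direction $r$).** $T^{n+1}$ solves $$\frac{T^{n+1}-T^\star}{\Delta t}-\partial_r\left(K_\perp\partial_rT^{n+1}\right)=0,\quad(s,r)\in\Omega,$$ with $\partial_rT^{n+1}(s,0)=-Q_\perp$ and $\partial_rT^{n+1}(s,1)=0$ for $s\in(0,1)$. All functions $T^n,T^\star$ are assumed regular enough for these equations and boundary conditions to make sense and for the equation of Step 2 and its boundary conditions to be differentiated with respect to $s$. In the hypothesis, $\|T^n(\cdot,r)\|_\infty$ is the sup norm over $s\in(0,1)$. *)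

theory Defs
  imports "HOL-Analysis.Analysis"
begin

definition Omega :: "(real \<times> real) set" where
  "Omega = {0<..<1} \<times> {0<..<1}"

text \<open>
  All functions live on the closed unit square; partial derivatives are taken along the
  closed unit interval, hence they are one-sided on the boundary and the usual
  two-sided ones in the interior.
\<close>

definition ds :: "(real \<times> real \<Rightarrow> real) \<Rightarrow> real \<times> real \<Rightarrow> real" where
  "ds f = (\<lambda>(s, r). vector_derivative (\<lambda>x. f (x, r)) (at s within {0..1}))"

definition dr :: "(real \<times> real \<Rightarrow> real) \<Rightarrow> real \<times> real \<Rightarrow> real" where
  "dr f = (\<lambda>(s, r). vector_derivative (\<lambda>y. f (s, y)) (at r within {0..1}))"

definition s_differentiable :: "(real \<times> real \<Rightarrow> real) \<Rightarrow> real \<times> real \<Rightarrow> bool" where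
  "s_differentiable f = (\<lambda>(s, r). (\<lambda>x. f (x, r)) differentiable (at s within {0..1}))"

definition r_differentiable :: "(real \<times> real \<Rightarrow> real) \<Rightarrow> real \<times> real \<Rightarrow> bool" where
  "r_differentiable f = (\<lambda>(s, r). (\<lambda>y. f (s, y)) differentiable (at r within {0..1}))"

text \<open>
  The boundary conditions in \<open>s\<close> change type at \<open>r = 1/2\<close>. In the first step \<open>r\<close> is only a
  parameter, so its solution is in general discontinuous in \<open>r\<close> across the line \<open>r = 1/2\<close>;
  joint regularity is therefore only required off that line.
\<close>

definition off_interface :: "(real \<times> real) set" where
  "off_interface = {0..1} \<times> ({0<..<1/2} \<union> {1/2<..<1})"

definition bounded_continuous_off_interface :: "(real \<times> real \<Rightarrow> real) \<Rightarrow> bool" where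
  "bounded_continuous_off_interface f \<longleftrightarrow>
     continuous_on off_interface f \<and> bounded (f ` off_interface)"

text \<open>Regularity of the initial datum and of the intermediate functions.\<close>

definition regular_in_s :: "(real \<times> real \<Rightarrow> real) \<Rightarrow> bool" where
  "regular_in_s f \<longleftrightarrow>
     (\<forall>p \<in> {0..1} \<times> {0<..<1}. s_differentiable f p) \<and>
     bounded_continuous_off_interface f \<and>
     bounded_continuous_off_interface (ds f)"

text \<open>
  Regularity of the functions produced by the second step. The mixed derivative is what allows
  the second step to be differentiated with respect to \<open>s\<close>. Second derivatives in \<open>r\<close>
  inherit the jump of the intermediate function and are not required to be continuous.
\<close>

definition regular_in_s_r :: "(real \<times> real \<Rightarrow> real) \<Rightarrow> bool" where
  "regular_in_s_r f \<longleftrightarrow>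
     (\<forall>p \<in> {0..1} \<times> {0..1}.
        s_differentiable f p \<and> r_differentiable f p \<and> s_differentiable (dr f) p) \<and>
     continuous_on ({0..1} \<times> {0..1}) f \<and>
     continuous_on ({0..1} \<times> {0..1}) (ds f) \<and>
     continuous_on ({0..1} \<times> {0..1}) (dr f) \<and>
     continuous_on ({0..1} \<times> {0..1}) (ds (dr f))"

definition explicit_flux ::
  "real \<Rightarrow> real \<Rightarrow> (real \<times> real \<Rightarrow> real) \<Rightarrow> real \<times> real \<Rightarrow> real" where
  "explicit_flux Kpar \<nu> T = (\<lambda>p. (Kpar * \<bar>T p\<bar> powr (5/2) - \<nu>) * ds T p)"

definition total_flux ::
  "real \<Rightarrow> real \<Rightarrow> (real \<times> real \<Rightarrow> real) \<Rightarrow> (real \<times> real \<Rightarrow> real)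
    \<Rightarrow> real \<times> real \<Rightarrow> real" where
  "total_flux Kpar \<nu> T Tstar = (\<lambda>p. explicit_flux Kpar \<nu> T p + \<nu> * ds Tstar p)"

definition imex_step_s ::
  "real \<Rightarrow> real \<Rightarrow> real \<Rightarrow> real \<Rightarrow> (real \<times> real \<Rightarrow> real) \<Rightarrow> (real \<times> real \<Rightarrow> real) \<Rightarrow> bool" where
  "imex_step_s Kpar \<gamma> \<nu> \<Delta>t T Tstar \<longleftrightarrow>
     (\<forall>p \<in> Omega.
        s_differentiable (explicit_flux Kpar \<nu> T) p \<and>
        s_differentiable (ds Tstar) p \<and>
        (Tstar p - T p) / \<Delta>t - ds (explicit_flux Kpar \<nu> T) p - \<nu> * ds (ds Tstar) p = 0) \<and>
     (\<forall>r \<in> {1/2<..<1}.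
        total_flux Kpar \<nu> T Tstar (0, r) = \<gamma> * Tstar (0, r) \<and>
        total_flux Kpar \<nu> T Tstar (1, r) = - \<gamma> * Tstar (1, r)) \<and>
     (\<forall>r \<in> {0<..<1/2}.
        Tstar (0, r) = Tstar (1, r) \<and>
        total_flux Kpar \<nu> T Tstar (0, r) = total_flux Kpar \<nu> T Tstar (1, r))"

text \<open>
  The equation of the second step is not imposed on the line \<open>r = 1/2\<close>, where a jump of
  \<open>Tstar\<close> prevents the second derivative in \<open>r\<close> from existing; continuity of \<open>Tnew\<close> and
  \<open>dr Tnew\<close> across that line is part of \<open>regular_in_s_r\<close>.
\<close>

definition imex_step_r ::
  "real \<Rightarrow> real \<Rightarrow> real \<Rightarrow> (real \<times> real \<Rightarrow> real) \<Rightarrow> (real \<times> real \<Rightarrow> real) \<Rightarrow> bool" where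
  "imex_step_r Kperp Qperp \<Delta>t Tstar Tnew \<longleftrightarrow>
     (\<forall>p \<in> Omega \<inter> off_interface.
        r_differentiable (\<lambda>q. Kperp * dr Tnew q) p \<and>
        (Tnew p - Tstar p) / \<Delta>t - dr (\<lambda>q. Kperp * dr Tnew q) p = 0) \<and>
     (\<forall>s \<in> {0<..<1}. dr Tnew (s, 0) = - Qperp \<and> dr Tnew (s, 1) = 0)"

definition imex_scheme ::
  "real \<Rightarrow> real \<Rightarrow> real \<Rightarrow> real \<Rightarrow> real \<Rightarrow> real
    \<Rightarrow> (nat \<Rightarrow> real \<times> real \<Rightarrow> real) \<Rightarrow> (nat \<Rightarrow> real \<times> real \<Rightarrow> real) \<Rightarrow> bool" where
  "imex_scheme Kpar Kperp \<gamma> Qperp \<nu> \<Delta>t T Tstar \<longleftrightarrow>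
     regular_in_s (T 0) \<and>
     (\<forall>n. regular_in_s (Tstar n) \<and> regular_in_s_r (T (Suc n)) \<and>
          imex_step_s Kpar \<gamma> \<nu> \<Delta>t (T n) (Tstar n) \<and>
          imex_step_r Kperp Qperp \<Delta>t (Tstar n) (T (Suc n)))"

text \<open>
  The supremum is a genuine one for the functions of the scheme: for \<open>0 < r < 1\<close> they are
  differentiable, hence continuous, in \<open>s\<close> on the compact unit interval.
\<close>

definition sup_norm_s :: "(real \<times> real \<Rightarrow> real) \<Rightarrow> real \<Rightarrow> real" where
  "sup_norm_s f r = (SUP s \<in> {0<..<1}. \<bar>f (s, r)\<bar>)"

end

theory Submission
  imports Defs
begin

text \<open>
  Each of the two steps dissipates the discrete energy
  \<open>E(f) = 1/2 \<integral> f\<^sup>2 + \<nu> \<Delta>t / 2 \<integral> |\<partial>\<^sub>s f|\<^sup>2\<close>, up to the source and dissipation terms in the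
  direction \<open>r\<close>; the estimate then telescopes over the time steps.

  Step in \<open>s\<close>. For fixed \<open>r\<close>, multiply the equation by \<open>T\<^sup>\<star>\<close> and integrate by parts. The boundary
  term \<open>[\<Phi> T\<^sup>\<star>]\<close> is \<open>- \<gamma> (T\<^sup>\<star>(0)\<^sup>2 + T\<^sup>\<star>(1)\<^sup>2)\<close> or, in the periodic part, zero. In \<open>- \<Phi> \<partial>\<^sub>s T\<^sup>\<star>\<close>
  the explicit part of the flux has a coefficient of size
  \<open>|\<nu> - K |T|\<^sup>5\<^sup>/\<^sup>2| \<le> \<nu>\<close>, as the viscosity condition ensures; Young's inequality splits it
  between \<open>\<partial>\<^sub>s T\<close> and \<open>\<partial>\<^sub>s T\<^sup>\<star>\<close>, and the implicit viscosity absorbs the second half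
  (lemmas \<open>s_step_slice\<close>, \<open>s_step_energy\<close>).

  Step in \<open>r\<close>. For fixed \<open>s\<close>, testing the heat equation with its solution \<open>V\<close> gives the bound on
  \<open>\<integral> V\<^sup>2\<close> together with the dissipation and the inflow \<open>Q V(s, 0)\<close> (lemma \<open>r_step_slice\<close>). The
  derivative \<open>\<partial>\<^sub>s V\<close> solves the same equation with homogeneous Neumann data, so
  \<open>\<integral> |\<partial>\<^sub>s V|\<^sup>2\<close> does not grow (lemma \<open>r_step_slice_ds\<close>). Differentiating the equation requires
  exchanging \<open>\<partial>\<^sub>s\<close> and \<open>\<partial>\<^sub>r\<close>, where the existence of \<open>\<partial>\<^sub>r \<partial>\<^sub>s\<close> has to be proved and not only its
  symmetry; this is lemma \<open>mixed_derivative_commutes\<close>, obtained from the Leibniz rule.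

  Both arguments produce, on each slice, a function that has a nonnegative integral and lies below
  the difference of the integrands of the two sides. Fubini's theorem turns this into an inequality over
  \<open>\<Omega>\<close>. The intermediate functions may jump across \<open>r = 1/2\<close>; in the step in \<open>r\<close> this is harmless
  because the fluxes stay continuous there, so that the fundamental theorem of calculus tolerates
  the exceptional point.
\<close>

section \<open>Partial derivatives and regularity classes\<close>

lemma ds_has_real_derivative:
  assumes "s_differentiable f (s, r)"
  shows "((\<lambda>x. f (x, r)) has_real_derivative ds f (s, r)) (at s within {0..1})"
  using assms unfolding s_differentiable_def ds_def
  by (simp add: has_real_derivative_iff_has_vector_derivative vector_derivative_works[symmetric])

lemma dr_has_real_derivative:
  assumes "r_differentiable f (s, r)"
  shows "((\<lambda>y. f (s, y)) has_real_derivative dr f (s, r)) (at r within {0..1})"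
  using assms unfolding r_differentiable_def dr_def
  by (simp add: has_real_derivative_iff_has_vector_derivative vector_derivative_works[symmetric])

lemma has_real_derivative_interior:
  fixes f :: "real \<Rightarrow> real"
  assumes "(f has_real_derivative d) (at x within {a..b})" "x \<in> {a<..<b}"
  shows "(f has_real_derivative d) (at x)"
  using assms by (simp add: at_within_Icc_at)

lemmas ds_at_interior = has_real_derivative_interior[OF ds_has_real_derivative]
lemmas dr_at_interior = has_real_derivative_interior[OF dr_has_real_derivative]

lemma continuous_on_s_slice:
  assumes "continuous_on off_interface f" "r \<in> {0<..<1} - {1/2}"
  shows "continuous_on {0..1} (\<lambda>s. f (s, r))"
  by (rule continuous_on_compose2[OF assms(1)])
     (use assms(2) in \<open>auto simp: off_interface_def intro!: continuous_intros\<close>)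

lemma continuous_on_r_slice:
  fixes f :: "real \<times> real \<Rightarrow> real"
  assumes "continuous_on ({0..1} \<times> {0..1}) f" "s \<in> {0<..<1}"
  shows "continuous_on {0..1} (\<lambda>r. f (s, r))"
  by (rule continuous_on_compose2[OF assms(1)])
     (use assms(2) in \<open>auto intro!: continuous_intros\<close>)

lemma regular_in_s_derivative:
  assumes "regular_in_s f" "r \<in> {0<..<1}" "s \<in> {0..1}"
  shows "((\<lambda>x. f (x, r)) has_real_derivative ds f (s, r)) (at s within {0..1})"
  using assms by (auto simp: regular_in_s_def intro!: ds_has_real_derivative)

text \<open>
  Differentiability in \<open>s\<close> gives continuity also on the line \<open>r = 1/2\<close>, on which
  \<open>continuous_on_s_slice\<close> says nothing.
\<close>

lemma regular_in_s_continuous: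
  assumes "regular_in_s f" "r \<in> {0<..<1}"
  shows "continuous_on {0..1} (\<lambda>s. f (s, r))"
  using regular_in_s_derivative[OF assms]
  by (meson DERIV_continuous continuous_on_eq_continuous_within)

lemma regular_in_s_r_imp_regular_in_s:
  assumes "regular_in_s_r f"
  shows "regular_in_s f"
proof -
  have *: "bounded_continuous_off_interface g"
    if "continuous_on ({0..1} \<times> {0..1}) g" for g :: "real \<times> real \<Rightarrow> real"
  proof -
    have sub: "off_interface \<subseteq> {0..1} \<times> {0..1}"
      by (auto simp: off_interface_def)
    have "bounded (g ` ({0..1} \<times> {0..1}))"
      by (intro compact_imp_bounded compact_continuous_image that compact_Times) auto
    then show ?thesis
      unfolding bounded_continuous_off_interface_def
      using continuous_on_subset[OF that sub] bounded_subset[OF _ image_mono[OF sub]] by blast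
  qed
  show ?thesis
    using assms unfolding regular_in_s_r_def regular_in_s_def by (auto intro!: *)
qed

section \<open>Exchanging the partial derivatives\<close>

text \<open>
  Of the second derivatives only \<open>\<partial>\<^sub>s \<partial>\<^sub>r G\<close> is given; that \<open>\<partial>\<^sub>s G\<close> is differentiable in \<open>r\<close> is part of the
  conclusion, so symmetry of second derivatives does not apply. Instead, differentiate
  \<open>G(x, y) - G(x, a) = \<integral>\<^sub>a\<^sup>y g(x, t) dt\<close> in \<open>x\<close> under the integral sign: this represents \<open>v(s, \<cdot>)\<close> as a
  primitive of the continuous function \<open>h(s, \<cdot>)\<close>.
\<close>

lemma mixed_derivative_commutes:
  fixes G g v h :: "real \<times> real \<Rightarrow> real"
  assumes Gr: "\<And>x y. x \<in> U \<Longrightarrow> y \<in> {a..b} \<Longrightarrow>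
      ((\<lambda>y. G (x, y)) has_real_derivative g (x, y)) (at y within {a..b})"
    and Gs: "\<And>x y. x \<in> U \<Longrightarrow> y \<in> {a..b} \<Longrightarrow>
      ((\<lambda>x. G (x, y)) has_real_derivative v (x, y)) (at x)"
    and gs: "\<And>x y. x \<in> U \<Longrightarrow> y \<in> {a..b} \<Longrightarrow>
      ((\<lambda>x. g (x, y)) has_real_derivative h (x, y)) (at x)"
    and cont: "continuous_on (U \<times> {a..b}) h"
    and U: "open U" "convex U" "s \<in> U" and r: "r \<in> {a..b}"
  shows "((\<lambda>y. v (s, y)) has_real_derivative h (s, r)) (at r within {a..b})"
proof -
  have integral_g: "((\<lambda>t. g (x, t)) has_integral (G (x, y) - G (x, a))) {a..y}"
    if "x \<in> U" "y \<in> {a..b}" for x y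
  proof (rule fundamental_theorem_of_calculus)
    show "((\<lambda>y. G (x, y)) has_vector_derivative g (x, t)) (at t within {a..y})"
      if "t \<in> {a..y}" for t
      using DERIV_subset[OF Gr[of x t], of "{a..y}"] \<open>x \<in> U\<close> \<open>y \<in> {a..b}\<close> that
      by (auto simp: has_real_derivative_iff_has_vector_derivative)
  qed (use that in auto)
  have v_eq: "v (s, y) = v (s, a) + integral {a..y} (\<lambda>t. h (s, t))" if y: "y \<in> {a..b}" for y
  proof -
    have "((\<lambda>x. integral (cbox a y) (\<lambda>t. g (x, t))) has_real_derivative
        integral (cbox a y) (\<lambda>t. h (s, t))) (at s within U)"
    proof (rule leibniz_rule_field_derivative[where fx = "\<lambda>x t. h (x, t)"])
      show "((\<lambda>x. g (x, t)) has_real_derivative h (x, t)) (at x within U)"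
        if "x \<in> U" "t \<in> cbox a y" for x t
        using gs[of x t] that y by (auto intro: has_field_derivative_at_within)
      show "(\<lambda>t. g (x, t)) integrable_on cbox a y" if "x \<in> U" for x
        using integral_g[OF that y] by (auto simp: integrable_on_def)
      show "continuous_on (U \<times> cbox a y) (\<lambda>(x, t). h (x, t))"
        using y by (auto intro!: continuous_on_subset[OF cont])
    qed (use U in auto)
    then have *: "((\<lambda>x. integral {a..y} (\<lambda>t. g (x, t))) has_real_derivative
        integral {a..y} (\<lambda>t. h (s, t))) (at s)"
      by (simp add: at_within_open[OF U(3,1)])
    have "((\<lambda>x. G (x, y) - G (x, a)) has_real_derivative
        integral {a..y} (\<lambda>t. h (s, t))) (at s)"
      by (rule has_field_derivative_transform_within_open[OF * U(1,3)])
         (use integral_unique[OF integral_g[OF _ y]] in auto)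
    moreover have "((\<lambda>x. G (x, y) - G (x, a)) has_real_derivative v (s, y) - v (s, a)) (at s)"
      using y U by (intro derivative_intros Gs) auto
    ultimately have "integral {a..y} (\<lambda>t. h (s, t)) = v (s, y) - v (s, a)"
      by (rule DERIV_unique)
    then show ?thesis
      by simp
  qed
  have "((\<lambda>y. v (s, a) + integral {a..y} (\<lambda>t. h (s, t))) has_real_derivative h (s, r))
      (at r within {a..b})"
  proof -
    have "continuous_on {a..b} (\<lambda>t. h (s, t))"
      by (rule continuous_on_compose2[OF cont]) (use U in \<open>auto intro!: continuous_intros\<close>)
    from integral_has_real_derivative[OF this r] show ?thesis
      by (auto intro!: derivative_eq_intros)
  qed
  then show ?thesis
    by (rule has_field_derivative_transform_within[OF _ zero_less_one r]) (rule v_eq[symmetric])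
qed

section \<open>Integration over the square by slices\<close>

text \<open>
  A derivative is a pointwise limit of difference quotients. The function is first extended
  constantly beyond the unit interval, since the quotients at a point reach out of it.
\<close>

lemma derivative_measurable_on_interior:
  fixes u d :: "real \<Rightarrow> real"
  assumes u: "\<And>x. x \<in> {0..1} \<Longrightarrow> (u has_real_derivative d x) (at x within {0..1})"
  shows "(\<lambda>x. indicator {0<..<1} x * d x) \<in> borel_measurable borel"
proof -
  define c where "c x = u (max 0 (min 1 x))" for x
  have "continuous_on {0..1} u"
    using u by (meson DERIV_continuous continuous_on_eq_continuous_within)
  then have "continuous_on UNIV c"
    unfolding c_def by (rule continuous_on_compose2) (auto intro!: continuous_intros)
  then have [measurable]: "c \<in> borel_measurable borel"
    by (rule borel_measurable_continuous_onI)
  show ?thesis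
  proof (rule borel_measurable_LIMSEQ_real)
    fix x :: real
    let ?q = "\<lambda>n. (c (x + inverse (real (Suc n))) - c x) / inverse (real (Suc n))"
    show "(\<lambda>n. indicator {0<..<1} x * ?q n) \<longlonglongrightarrow> indicator {0<..<1} x * d x"
    proof (cases "x \<in> {0<..<1}")
      case True
      have "(u has_real_derivative d x) (at x)"
        using u[of x] True by (auto intro: has_real_derivative_interior)
      then have "(c has_real_derivative d x) (at x)"
        by (rule has_field_derivative_transform_within_open[where S = "{0<..<1}"])
           (use True in \<open>auto simp: c_def max_def min_def\<close>)
      moreover have "filterlim (\<lambda>n. inverse (real (Suc n))) (at 0) sequentially"
        using LIMSEQ_inverse_real_of_nat by (auto simp: filterlim_at)
      ultimately have "?q \<longlonglongrightarrow> d x"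
        using filterlim_compose[of "\<lambda>h. (c (x + h) - c x) / h" "nhds (d x)" "at 0"]
        by (simp add: DERIV_def)
      then show ?thesis
        by (intro tendsto_intros)
    qed simp
  qed measurable
qed

lemma Omega_sets [measurable]: "Omega \<in> sets borel"
  unfolding Omega_def by (intro borel_open open_Times) auto

lemma emeasure_Omega: "emeasure lborel Omega = 1"
proof -
  have "emeasure (lborel \<Otimes>\<^sub>M lborel) Omega = (1 :: ennreal)"
    unfolding Omega_def by (subst lborel.emeasure_pair_measure_Times) auto
  then show ?thesis
    by (simp add: lborel_prod)
qed

lemma AE_off_line: "AE p in (lborel :: (real \<times> real) measure). snd p \<noteq> c"
proof (rule AE_I)
  have "emeasure (lborel \<Otimes>\<^sub>M lborel) (UNIV \<times> {c}) = (0 :: ennreal)"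
    by (subst lborel.emeasure_pair_measure_Times) auto
  then show "emeasure lborel (UNIV \<times> {c} :: (real \<times> real) set) = 0"
    by (simp add: lborel_prod)
qed (auto intro!: borel_closed closed_Times)

text \<open>
  The line \<open>r = 1/2\<close> is a null set, but Lebesgue integrals over \<^const>\<open>lborel\<close> require Borel
  measurability, which does not follow from measurability almost everywhere; hence the
  hypothesis on that line.
\<close>

lemma square_integrable_of_bounded_off_interface:
  assumes f: "bounded_continuous_off_interface f"
    and line: "(\<lambda>s. indicator {0<..<1} s * f (s, 1/2)) \<in> borel_measurable borel"
  shows "set_integrable lborel Omega (\<lambda>p. (f p)\<^sup>2)"
proof -
  define g where "g p = indicator Omega p * f p" for p
  let ?A = "Omega \<inter> off_interface"
  have A: "?A = {0<..<1} \<times> ({0<..<1/2} \<union> {1/2<..<1})"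
    by (auto simp: Omega_def off_interface_def)
  have "?A \<in> sets borel"
    unfolding A by (intro borel_open open_Times open_Un) auto
  then have A_part: "(\<lambda>p. indicator ?A p *\<^sub>R f p) \<in> borel_measurable borel"
    using f unfolding bounded_continuous_off_interface_def
    by (intro borel_measurable_continuous_on_indicator) (auto intro: continuous_on_subset)
  have "g = (\<lambda>p. indicator ?A p *\<^sub>R f p
      + indicator {1/2} (snd p) * (indicator {0<..<1} (fst p) * f (fst p, 1/2)))"
  proof
    fix p :: "real \<times> real"
    show "g p = indicator ?A p *\<^sub>R f p
      + indicator {1/2} (snd p) * (indicator {0<..<1} (fst p) * f (fst p, 1/2))"
    proof (cases "snd p = 1/2")
      case True
      then obtain a where "p = (a, 1/2)"
        by (metis prod.collapse)
      then show ?thesis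
        by (simp add: g_def Omega_def off_interface_def indicator_def)
    next
      case False
      then show ?thesis
        by (cases p) (auto simp: g_def Omega_def off_interface_def indicator_def)
    qed
  qed
  moreover have line': "(\<lambda>p::real\<times>real. indicator {0<..<1} (fst p) * f (fst p, 1/2)) \<in> borel_measurable borel"
    using measurable_compose[OF borel_measurable_continuous_onI[OF continuous_on_fst[OF continuous_on_id]] line]
    by simp
  moreover have "(\<lambda>p::real\<times>real. indicator {1/2} (snd p) :: real) \<in> borel_measurable borel"
    using measurable_compose[OF borel_measurable_continuous_onI[OF continuous_on_snd[OF continuous_on_id]],
        of "indicator {1/2} :: real \<Rightarrow> real" borel]
    by simp
  ultimately have [measurable]: "g \<in> borel_measurable borel"
    by (simp only:) (intro borel_measurable_add borel_measurable_times[OF _ line'] A_part)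
  obtain B where B: "\<And>p. p \<in> off_interface \<Longrightarrow> \<bar>f p\<bar> \<le> B"
    using f unfolding bounded_continuous_off_interface_def bounded_iff by auto
  have "integrable lborel (\<lambda>p. (g p)\<^sup>2)"
  proof (rule integrableI_bounded_set[where A = Omega and B = "B\<^sup>2"])
    show "AE p in lborel. p \<in> Omega \<longrightarrow> norm ((g p)\<^sup>2) \<le> B\<^sup>2"
      using AE_off_line[of "1/2"]
    proof eventually_elim
      case (elim p)
      show ?case
      proof
        assume "p \<in> Omega"
        with elim have "p \<in> off_interface"
          by (cases p) (auto simp: Omega_def off_interface_def)
        with B \<open>p \<in> Omega\<close> show "norm ((g p)\<^sup>2) \<le> B\<^sup>2"
          using power_mono[of "\<bar>f p\<bar>" B 2] by (simp add: g_def)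
      qed
    qed
    show "(\<lambda>p. (g p)\<^sup>2) \<in> borel_measurable lborel"
      by measurable
  qed (auto simp: g_def emeasure_Omega)
  moreover have "(\<lambda>p. (g p)\<^sup>2) = (\<lambda>p. indicator Omega p *\<^sub>R (f p)\<^sup>2)"
    by (auto simp: g_def indicator_def)
  ultimately show ?thesis
    by (simp add: set_integrable_def)
qed

lemma regular_in_s_square_integrable:
  assumes "regular_in_s f"
  shows "set_integrable lborel Omega (\<lambda>p. (f p)\<^sup>2)"
    and "set_integrable lborel Omega (\<lambda>p. (ds f p)\<^sup>2)"
proof -
  have "continuous_on {0..1} (\<lambda>s. f (s, 1/2))"
    using assms by (rule regular_in_s_continuous) simp
  then have "continuous_on {0<..<1} (\<lambda>s. f (s, 1/2))"
    by (rule continuous_on_subset) auto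
  from borel_measurable_continuous_on_indicator[OF _ this]
  have "(\<lambda>s. indicator {0<..<1} s * f (s, 1/2)) \<in> borel_measurable borel"
    by simp
  then show "set_integrable lborel Omega (\<lambda>p. (f p)\<^sup>2)"
    using assms by (intro square_integrable_of_bounded_off_interface) (auto simp: regular_in_s_def)
  show "set_integrable lborel Omega (\<lambda>p. (ds f p)\<^sup>2)"
    using assms derivative_measurable_on_interior[OF regular_in_s_derivative[OF assms]]
    by (intro square_integrable_of_bounded_off_interface) (auto simp: regular_in_s_def)
qed

lemma set_integrable_continuous_on_square:
  fixes f :: "real \<times> real \<Rightarrow> real"
  assumes "continuous_on ({0..1} \<times> {0..1}) f"
  shows "set_integrable lborel Omega f"
proof (rule set_integrable_subset)
  show "set_integrable lborel ({0..1} \<times> {0..1}) f"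
    unfolding set_integrable_def by (intro borel_integrable_compact compact_Times assms) auto
qed (auto simp: Omega_def intro!: borel_open open_Times)

text \<open>
  What integration by parts delivers on a slice. The integral of the minorant \<open>q\<close> is the gauge
  integral produced by the fundamental theorem of calculus, so that no absolute integrability of
  \<open>q\<close> has to be checked; the point \<open>1/2\<close> is left out because of the interface.
\<close>

definition has_nonneg_minorant :: "(real \<Rightarrow> real) \<Rightarrow> bool" where
  "has_nonneg_minorant f \<longleftrightarrow>
     (\<exists>q I. 0 \<le> I \<and> (q has_integral I) {0..1} \<and> (\<forall>x\<in>{0<..<1} - {1/2}. q x \<le> f x))"

text \<open>
  If \<open>f\<close> is not integrable its Lebesgue integral is 0 by convention, which makes the claim hold on
  every slice and not only on almost every one.
\<close>

lemma LBINT_nonneg_of_minorant: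
  assumes "has_nonneg_minorant f"
  shows "0 \<le> (LBINT x:{0<..<1}. f x)"
proof (cases "set_integrable lborel {0<..<1} f")
  case True
  obtain q I where q: "0 \<le> I" "(q has_integral I) {0..1}" "\<And>x. x \<in> {0<..<1} - {1/2} \<Longrightarrow> q x \<le> f x"
    using assms unfolding has_nonneg_minorant_def by blast
  note f = set_borel_integral_eq_integral[OF True]
  have "((\<lambda>x. if x = 1/2 then f x else q x) has_integral I) {0<..<1}"
    by (rule has_integral_spike_finite[where S = "{1/2}" and f = q])
       (use q(2) in \<open>auto simp: has_integral_Icc_iff_Ioo\<close>)
  from has_integral_le[OF this integrable_integral[OF f(1)]]
  have "I \<le> integral {0<..<1} f"
    using q(3) by auto
  then show ?thesis
    using q(1) f(2) by simp
next
  case False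
  then show ?thesis
    unfolding set_integrable_def set_lebesgue_integral_def by (simp add: not_integrable_integral_eq)
qed

lemma LBINT_Omega_iterated:
  fixes f :: "real \<times> real \<Rightarrow> real"
  assumes "set_integrable lborel Omega f"
  shows "(LBINT p:Omega. f p) = (LBINT s:{0<..<1}. (LBINT r:{0<..<1}. f (s, r)))"
    and "(LBINT p:Omega. f p) = (LBINT r:{0<..<1}. (LBINT s:{0<..<1}. f (s, r)))"
proof -
  let ?F = "\<lambda>s r. indicator {0<..<1} s * (indicator {0<..<1} r * f (s, r)) :: real"
  have F: "(\<lambda>p. indicator Omega p *\<^sub>R f p) = case_prod ?F"
    by (auto simp: fun_eq_iff Omega_def indicator_def)
  have int: "integrable (lborel \<Otimes>\<^sub>M lborel) (case_prod ?F)"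
    using assms unfolding set_integrable_def F lborel_prod .
  show "(LBINT p:Omega. f p) = (LBINT s:{0<..<1}. (LBINT r:{0<..<1}. f (s, r)))"
    using lborel_pair.integral_fst[OF int]
    unfolding set_lebesgue_integral_def F lborel_prod by simp
  show "(LBINT p:Omega. f p) = (LBINT r:{0<..<1}. (LBINT s:{0<..<1}. f (s, r)))"
    using lborel_pair.integral_snd[OF int]
    unfolding set_lebesgue_integral_def F lborel_prod by (simp add: mult.left_commute)
qed

lemma LBINT_Omega_nonneg_by_s_slices:
  assumes "set_integrable lborel Omega f"
    and "\<And>r. r \<in> {0<..<1} - {1/2} \<Longrightarrow> has_nonneg_minorant (\<lambda>s. f (s, r))"
  shows "0 \<le> (LBINT p:Omega. f p)"
proof -
  have "AE r in lborel. 0 \<le> indicator {0<..<1} r *\<^sub>R (LBINT s:{0<..<1}. f (s, r))"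
    using AE_lborel_singleton[of "1/2 :: real"]
    by eventually_elim (use LBINT_nonneg_of_minorant[OF assms(2)] in \<open>auto simp: indicator_def\<close>)
  then show ?thesis
    unfolding LBINT_Omega_iterated(2)[OF assms(1)]
    by (subst set_lebesgue_integral_def) (rule integral_nonneg_AE)
qed

lemma LBINT_Omega_nonneg_by_r_slices:
  assumes "set_integrable lborel Omega f"
    and "\<And>s. s \<in> {0<..<1} \<Longrightarrow> has_nonneg_minorant (\<lambda>r. f (s, r))"
  shows "0 \<le> (LBINT p:Omega. f p)"
proof -
  have "0 \<le> indicator {0<..<1} s *\<^sub>R (LBINT r:{0<..<1}. f (s, r))" for s
    using LBINT_nonneg_of_minorant[OF assms(2)] by (auto simp: indicator_def)
  then show ?thesis
    unfolding LBINT_Omega_iterated(1)[OF assms(1)]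
    by (subst set_lebesgue_integral_def) (intro integral_nonneg_AE AE_I2)
qed

section \<open>The step in the direction \<open>s\<close>\<close>

text \<open>
  Continuity on the compact unit interval makes the supremum in the norm a genuine upper bound.
\<close>

lemma coefficient_le_viscosity:
  assumes f: "regular_in_s f" and K: "0 \<le> K" and r: "r \<in> {0<..<1}"
    and bound: "K * sup_norm_s f r powr (5/2) \<le> \<nu>" and s: "s \<in> {0<..<1}"
  shows "K * \<bar>f (s, r)\<bar> powr (5/2) \<le> \<nu>"
proof -
  have "continuous_on {0..1} (\<lambda>x. f (x, r))"
    by (rule regular_in_s_continuous[OF f r])
  then have "bounded ((\<lambda>x. \<bar>f (x, r)\<bar>) ` {0..1})"
    by (intro compact_imp_bounded compact_continuous_image continuous_intros) auto
  then have "bdd_above ((\<lambda>x. \<bar>f (x, r)\<bar>) ` {0<..<1})"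
    by (rule bdd_above_mono[OF bounded_imp_bdd_above]) auto
  then have "\<bar>f (s, r)\<bar> \<le> sup_norm_s f r"
    unfolding sup_norm_s_def using s by (intro cSUP_upper) auto
  then have "K * \<bar>f (s, r)\<bar> powr (5/2) \<le> K * sup_norm_s f r powr (5/2)"
    using K by (intro mult_left_mono powr_mono2) auto
  with bound show ?thesis
    by simp
qed

text \<open>
  With \<open>k = K |T|\<^sup>5\<^sup>/\<^sup>2\<close>, \<open>E = \<partial>\<^sub>s T\<close> and \<open>D = \<partial>\<^sub>s T\<^sup>\<star>\<close>, the left-hand side is \<open>- \<Phi> \<partial>\<^sub>s T\<^sup>\<star>\<close>. Since
  \<open>0 \<le> \<nu> - k \<le> \<nu>\<close>, Young's inequality bounds \<open>(\<nu> - k) E D\<close> by \<open>\<nu>/2 (E\<^sup>2 + D\<^sup>2)\<close>, and half of the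
  implicit term \<open>\<nu> D\<^sup>2\<close> survives.
\<close>

lemma s_step_young:
  fixes k \<nu> :: real
  assumes "0 \<le> k" "k \<le> \<nu>"
  shows "- (((k - \<nu>) * E + \<nu> * D) * D) \<le> \<nu>/2 * E\<^sup>2 - \<nu>/2 * D\<^sup>2"
proof -
  have "(\<nu> - k) * (E * D) \<le> (\<nu> - k) * ((E\<^sup>2 + D\<^sup>2) / 2)"
    using assms sum_squares_bound[of E D] by (intro mult_left_mono) auto
  also have "\<dots> \<le> \<nu> * ((E\<^sup>2 + D\<^sup>2) / 2)"
    using assms by (intro mult_right_mono) auto
  finally show ?thesis
    by (simp add: algebra_simps power2_eq_square)
qed

text \<open>
  The minorant is \<open>- \<Delta>t (\<Phi> U)'\<close>, so its integral is \<open>- \<Delta>t\<close> times the boundary term \<open>[\<Phi> U]\<close>. That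
  term is nonpositive by the condition with \<open>\<gamma>\<close> for \<open>r > 1/2\<close> and zero by periodicity for
  \<open>r < 1/2\<close>. Only interior derivatives of \<open>\<Phi>\<close> enter, \<open>\<Phi>\<close> itself being continuous up to the boundary.
\<close>

lemma s_step_slice:
  assumes T: "regular_in_s T" and U: "regular_in_s U"
    and step: "imex_step_s K \<gamma> \<nu> \<Delta>t T U"
    and const: "0 \<le> K" "0 \<le> \<gamma>" "0 < \<Delta>t"
    and r: "r \<in> {0<..<1} - {1/2}"
    and bound: "\<And>s. s \<in> {0<..<1} \<Longrightarrow> K * \<bar>T (s, r)\<bar> powr (5/2) \<le> \<nu>"
  shows "has_nonneg_minorant (\<lambda>s. (1/2 * (T (s, r))\<^sup>2 + \<nu> * \<Delta>t / 2 * (ds T (s, r))\<^sup>2)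
      - (1/2 * (U (s, r))\<^sup>2 + \<nu> * \<Delta>t / 2 * (ds U (s, r))\<^sup>2))"
proof -
  define \<Phi> where "\<Phi> s = total_flux K \<nu> T U (s, r)" for s
  define q where "q s = - (\<Delta>t * ((U (s, r) - T (s, r)) / \<Delta>t * U (s, r) + ds U (s, r) * \<Phi> s))" for s
  have r': "r \<in> {0<..<1}"
    using r by simp
  have cont: "continuous_on {0..1} (\<lambda>s. f (s, r))" if "f \<in> {T, ds T, U, ds U}" for f
    using that T U continuous_on_s_slice[OF _ r]
    unfolding regular_in_s_def bounded_continuous_off_interface_def by auto
  have cont_\<Phi>: "continuous_on {0..1} \<Phi>"
    unfolding \<Phi>_def total_flux_def explicit_flux_def
    by (intro continuous_intros cont continuous_on_powr') auto
  have deriv: "((\<lambda>s. \<Phi> s * U (s, r)) has_real_derivative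
      (U (s, r) - T (s, r)) / \<Delta>t * U (s, r) + ds U (s, r) * \<Phi> s) (at s)"
    if s: "s \<in> {0<..<1}" for s
  proof (rule DERIV_mult)
    have p: "(s, r) \<in> Omega"
      using s r' by (simp add: Omega_def)
    have "((\<lambda>s. explicit_flux K \<nu> T (s, r) + \<nu> * ds U (s, r)) has_real_derivative
        ds (explicit_flux K \<nu> T) (s, r) + \<nu> * ds (ds U) (s, r)) (at s)"
      using step p s unfolding imex_step_s_def
      by (auto intro!: derivative_intros DERIV_cmult ds_at_interior)
    moreover have "ds (explicit_flux K \<nu> T) (s, r) + \<nu> * ds (ds U) (s, r) = (U (s, r) - T (s, r)) / \<Delta>t"
      using step p unfolding imex_step_s_def by force
    ultimately show "(\<Phi> has_real_derivative (U (s, r) - T (s, r)) / \<Delta>t) (at s)"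
      by (simp add: \<Phi>_def[abs_def] total_flux_def)
    show "((\<lambda>s. U (s, r)) has_real_derivative ds U (s, r)) (at s)"
      using U s r' unfolding regular_in_s_def by (auto intro!: ds_at_interior)
  qed
  have "((\<lambda>s. (U (s, r) - T (s, r)) / \<Delta>t * U (s, r) + ds U (s, r) * \<Phi> s) has_integral
      \<Phi> 1 * U (1, r) - \<Phi> 0 * U (0, r)) {0..1}"
    by (rule fundamental_theorem_of_calculus_interior)
       (use deriv in \<open>auto simp: has_real_derivative_iff_has_vector_derivative
          intro!: continuous_on_mult cont_\<Phi> cont\<close>)
  from has_integral_neg[OF has_integral_mult_right[OF this, of \<Delta>t]]
  have "(q has_integral - (\<Delta>t * (\<Phi> 1 * U (1, r) - \<Phi> 0 * U (0, r)))) {0..1}"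
    by (simp add: q_def[abs_def])
  moreover have "\<Phi> 1 * U (1, r) - \<Phi> 0 * U (0, r) \<le> 0"
  proof (cases "r < 1/2")
    case True
    then show ?thesis
      using step r unfolding imex_step_s_def \<Phi>_def by simp
  next
    case False
    then have "\<Phi> 0 = \<gamma> * U (0, r)" "\<Phi> 1 = - \<gamma> * U (1, r)"
      using step r unfolding imex_step_s_def \<Phi>_def by auto
    then have "\<Phi> 1 * U (1, r) - \<Phi> 0 * U (0, r) = - (\<gamma> * ((U (0, r))\<^sup>2 + (U (1, r))\<^sup>2))"
      by (simp add: power2_eq_square algebra_simps)
    then show ?thesis
      using const by simp
  qed
  then have "0 \<le> - (\<Delta>t * (\<Phi> 1 * U (1, r) - \<Phi> 0 * U (0, r)))"
    using const by (simp add: mult_le_0_iff)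
  moreover have "q s \<le> (1/2 * (T (s, r))\<^sup>2 + \<nu> * \<Delta>t / 2 * (ds T (s, r))\<^sup>2)
      - (1/2 * (U (s, r))\<^sup>2 + \<nu> * \<Delta>t / 2 * (ds U (s, r))\<^sup>2)" if s: "s \<in> {0<..<1}" for s
  proof -
    have q_eq: "q s = - ((U (s, r) - T (s, r)) * U (s, r)) + \<Delta>t * - (\<Phi> s * ds U (s, r))"
      using const by (simp add: q_def field_simps)
    have "- (\<Phi> s * ds U (s, r)) \<le> \<nu>/2 * (ds T (s, r))\<^sup>2 - \<nu>/2 * (ds U (s, r))\<^sup>2"
      unfolding \<Phi>_def total_flux_def explicit_flux_def
      by (rule s_step_young) (use bound[OF s] const in auto)
    then have "\<Delta>t * - (\<Phi> s * ds U (s, r)) \<le> \<Delta>t * (\<nu>/2 * (ds T (s, r))\<^sup>2 - \<nu>/2 * (ds U (s, r))\<^sup>2)"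
      using const by (intro mult_left_mono) auto
    moreover have "- ((U (s, r) - T (s, r)) * U (s, r)) \<le> 1/2 * (T (s, r))\<^sup>2 - 1/2 * (U (s, r))\<^sup>2"
      using sum_squares_bound[of "T (s, r)" "U (s, r)"] by (simp add: power2_eq_square algebra_simps)
    ultimately show ?thesis
      unfolding q_eq by (simp add: algebra_simps)
  qed
  ultimately show ?thesis
    unfolding has_nonneg_minorant_def by blast
qed

section \<open>The step in the direction \<open>r\<close>\<close>

text \<open>
  Here the minorant has integral exactly 0: it is \<open>\<Delta>t\<close> times the difference between the boundary
  term \<open>K Q V(s, 0)\<close>, taken as a constant in \<open>r\<close>, and the derivative of \<open>K \<partial>\<^sub>r V \<cdot> V\<close>. The trace
  \<open>V(s, 0)\<close> thereby becomes part of the integrand over the square.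
\<close>

lemma r_step_slice:
  assumes V: "regular_in_s_r V" and U: "regular_in_s U"
    and step: "imex_step_r K Q \<Delta>t U V"
    and const: "0 < \<Delta>t" and s: "s \<in> {0<..<1}"
  shows "has_nonneg_minorant (\<lambda>r. 1/2 * (U (s, r))\<^sup>2 - 1/2 * (V (s, r))\<^sup>2
      - K * \<Delta>t * ((dr V (s, r))\<^sup>2 - Q * V (s, 0)))"
proof -
  define F where "F r = K * dr V (s, r) * V (s, r)" for r
  define F' where "F' r = (V (s, r) - U (s, r)) / \<Delta>t * V (s, r) + dr V (s, r) * (K * dr V (s, r))" for r
  have "(F' has_integral F 1 - F 0) {0..1}"
  proof (rule fundamental_theorem_of_calculus_interior_strong[where S = "{1/2}"])
    show "continuous_on {0..1} F"
      unfolding F_def using V s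
      by (intro continuous_intros continuous_on_r_slice) (auto simp: regular_in_s_r_def)
    show "(F has_vector_derivative F' r) (at r)" if r: "r \<in> {0<..<1} - {1/2}" for r
    proof -
      have p: "(s, r) \<in> Omega \<inter> off_interface"
        using s r by (auto simp: Omega_def off_interface_def)
      have flux: "((\<lambda>r. K * dr V (s, r)) has_real_derivative dr (\<lambda>q. K * dr V q) (s, r)) (at r)"
        using step p r unfolding imex_step_r_def by (intro dr_at_interior) auto
      have eq: "dr (\<lambda>q. K * dr V q) (s, r) = (V (s, r) - U (s, r)) / \<Delta>t"
        using step p unfolding imex_step_r_def by force
      have "((\<lambda>r. V (s, r)) has_real_derivative dr V (s, r)) (at r)"
        using V s r unfolding regular_in_s_r_def by (intro dr_at_interior) auto
      from DERIV_mult[OF flux[unfolded eq] this] show ?thesis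
        unfolding F_def F'_def has_real_derivative_iff_has_vector_derivative[symmetric] .
    qed
  qed auto
  moreover have "F 1 - F 0 = K * Q * V (s, 0)"
    using step s by (simp add: F_def imex_step_r_def)
  ultimately have F': "(F' has_integral K * Q * V (s, 0)) {0..1}"
    by simp
  have "((\<lambda>r. \<Delta>t * (K * Q * V (s, 0) - F' r)) has_integral \<Delta>t * (K * Q * V (s, 0) - K * Q * V (s, 0))) {0..1}"
    by (intro has_integral_mult_right has_integral_diff F')
       (metis content_real_if diff_zero has_integral_const_real scaleR_one zero_le_one)
  moreover have "\<Delta>t * (K * Q * V (s, 0) - F' r) \<le> 1/2 * (U (s, r))\<^sup>2 - 1/2 * (V (s, r))\<^sup>2
      - K * \<Delta>t * ((dr V (s, r))\<^sup>2 - Q * V (s, 0))" for r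
  proof -
    have "\<Delta>t * (K * Q * V (s, 0) - F' r) = - ((V (s, r) - U (s, r)) * V (s, r))
        - K * \<Delta>t * ((dr V (s, r))\<^sup>2 - Q * V (s, 0))"
      using const by (simp add: F'_def power2_eq_square field_simps)
    then show ?thesis
      using sum_squares_bound[of "U (s, r)" "V (s, r)"]
      by (simp add: power2_eq_square algebra_simps)
  qed
  ultimately show ?thesis
    unfolding has_nonneg_minorant_def
    by (intro exI[of _ "\<lambda>r. \<Delta>t * (K * Q * V (s, 0) - F' r)"] exI[of _ 0]) auto
qed

text \<open>
  The equation differentiated in \<open>s\<close>. Since \<open>\<partial>\<^sub>s U\<close> is continuous only off the interface, the
  derivatives are exchanged on a small interval \<open>[a, b]\<close> around \<open>r\<close> that stays on one side of
  \<open>1/2\<close>; the endpoints are midpoints between \<open>r\<close> and the ends of its half of the unit interval.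
\<close>

lemma r_step_differentiated:
  assumes V: "regular_in_s_r V" and U: "regular_in_s U"
    and step: "imex_step_r K Q \<Delta>t U V"
    and const: "0 < \<Delta>t" and s: "s \<in> {0<..<1}" and r: "r \<in> {0<..<1} - {1/2}"
  shows "((\<lambda>y. K * ds (dr V) (s, y)) has_real_derivative (ds V (s, r) - ds U (s, r)) / \<Delta>t) (at r)"
proof -
  define a where "a = (if r < 1/2 then r/2 else (r + 1/2) / 2)"
  define b where "b = (if r < 1/2 then (r + 1/2) / 2 else (r + 1) / 2)"
  have ab: "r \<in> {a<..<b}" "{a..b} \<subseteq> {0<..<1/2} \<union> {1/2<..<1}"
    using r by (auto simp: a_def b_def split: if_splits)
  have p: "(x, y) \<in> Omega \<inter> off_interface" and y_inner: "y \<in> {0<..<1}"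
    if "x \<in> {0<..<1}" "y \<in> {a..b}" for x y
    using that ab(2) by (auto simp: Omega_def off_interface_def)
  have "((\<lambda>y. K * ds (dr V) (s, y)) has_real_derivative (ds V (s, r) - ds U (s, r)) / \<Delta>t)
      (at r within {a..b})"
  proof (rule mixed_derivative_commutes[where U = "{0<..<1}"
        and G = "\<lambda>q. K * dr V q" and g = "\<lambda>q. (V q - U q) / \<Delta>t"
        and v = "\<lambda>q. K * ds (dr V) q" and h = "\<lambda>q. (ds V q - ds U q) / \<Delta>t", simplified])
    fix x y :: real assume x: "0 < x \<and> x < 1" and y: "a \<le> y \<and> y \<le> b"
    note xy = p[of x y] y_inner[of x y]
    have "((\<lambda>y. K * dr V (x, y)) has_real_derivative dr (\<lambda>q. K * dr V q) (x, y)) (at y)"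
      using step x y xy unfolding imex_step_r_def by (intro dr_at_interior) auto
    moreover have "dr (\<lambda>q. K * dr V q) (x, y) = (V (x, y) - U (x, y)) / \<Delta>t"
      using step x y xy unfolding imex_step_r_def by force
    ultimately show "((\<lambda>y. K * dr V (x, y)) has_real_derivative (V (x, y) - U (x, y)) / \<Delta>t)
        (at y within {a..b})"
      by (simp add: has_field_derivative_at_within)
    show "((\<lambda>x. K * dr V (x, y)) has_real_derivative K * ds (dr V) (x, y)) (at x)"
      using V x y xy unfolding regular_in_s_r_def by (intro DERIV_cmult ds_at_interior) auto
    show "((\<lambda>x. (V (x, y) - U (x, y)) / \<Delta>t) has_real_derivative (ds V (x, y) - ds U (x, y)) / \<Delta>t) (at x)"
      using V U x y xy unfolding regular_in_s_r_def regular_in_s_def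
      by (intro DERIV_cdivide DERIV_diff ds_at_interior) auto
  next
    have "{0<..<1} \<times> {a..b} \<subseteq> off_interface"
      using p by blast
    moreover have "{0<..<1 :: real} \<times> {a..b} \<subseteq> {0..1} \<times> {0..1}"
      using ab by (intro Sigma_mono) (auto simp: subset_iff)
    moreover have "continuous_on off_interface (ds U)" "continuous_on ({0..1} \<times> {0..1}) (ds V)"
      using U V unfolding regular_in_s_def bounded_continuous_off_interface_def regular_in_s_r_def
      by blast+
    ultimately have "continuous_on ({0<..<1} \<times> {a..b}) (ds U)" "continuous_on ({0<..<1} \<times> {a..b}) (ds V)"
      by (metis continuous_on_subset)+
    then show "continuous_on ({0<..<1} \<times> {a..b}) (\<lambda>q. (ds V q - ds U q) / \<Delta>t)"
      using const by (intro continuous_intros) auto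
  qed (use s ab(1) in auto)
  then show ?thesis
    using ab(1) by (rule has_real_derivative_interior)
qed

text \<open>
  The function \<open>\<partial>\<^sub>s V\<close> satisfies the equation of the step with \<open>\<partial>\<^sub>s U\<close> as datum, and its flux vanishes
  at both ends because \<open>\<partial>\<^sub>r V\<close> is constant in \<open>s\<close> there. Testing with \<open>\<partial>\<^sub>s V\<close> leaves no boundary term,
  and the dissipation \<open>K |\<partial>\<^sub>r \<partial>\<^sub>s V|\<^sup>2\<close> is dropped.
\<close>

lemma r_step_slice_ds:
  assumes V: "regular_in_s_r V" and U: "regular_in_s U"
    and step: "imex_step_r K Q \<Delta>t U V"
    and const: "0 \<le> K" "0 < \<Delta>t" and s: "s \<in> {0<..<1}"
  shows "has_nonneg_minorant (\<lambda>r. 1/2 * (ds U (s, r))\<^sup>2 - 1/2 * (ds V (s, r))\<^sup>2)"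
proof -
  define F where "F r = K * ds (dr V) (s, r) * ds V (s, r)" for r
  define F' where "F' r = (ds V (s, r) - ds U (s, r)) / \<Delta>t * ds V (s, r)
      + ds (dr V) (s, r) * (K * ds (dr V) (s, r))" for r
  have dr_ds: "((\<lambda>y. ds V (s, y)) has_real_derivative ds (dr V) (s, r)) (at r)"
    if r: "r \<in> {0<..<1}" for r
  proof -
    have "((\<lambda>y. ds V (s, y)) has_real_derivative ds (dr V) (s, r)) (at r within {0..1})"
    proof (rule mixed_derivative_commutes[where U = "{0<..<1}" and G = V and g = "dr V"])
      show "continuous_on ({0<..<1} \<times> {0..1}) (ds (dr V))"
        using V unfolding regular_in_s_r_def by (auto intro: continuous_on_subset)
    qed (use V s r in \<open>auto simp: regular_in_s_r_def intro!: dr_has_real_derivative ds_at_interior\<close>)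
    then show ?thesis
      using r by (rule has_real_derivative_interior)
  qed
  have flux_zero: "ds (dr V) (s, y) = 0" if y: "y \<in> {0, 1}" for y
  proof -
    have "((\<lambda>x. dr V (x, y)) has_real_derivative ds (dr V) (s, y)) (at s)"
      using V s y unfolding regular_in_s_r_def by (intro ds_at_interior) auto
    moreover have "((\<lambda>x. dr V (x, y)) has_real_derivative 0) (at s)"
      by (rule has_field_derivative_transform_within_open[where S = "{0<..<1}"
            and f = "\<lambda>_. if y = 0 then - Q else 0"])
         (use step s y in \<open>auto simp: imex_step_r_def\<close>)
    ultimately show ?thesis
      by (rule DERIV_unique)
  qed
  have "(F' has_integral F 1 - F 0) {0..1}"
  proof (rule fundamental_theorem_of_calculus_interior_strong[where S = "{1/2}"])
    show "continuous_on {0..1} F"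
      unfolding F_def using V s
      by (intro continuous_intros continuous_on_r_slice) (auto simp: regular_in_s_r_def)
    show "(F has_vector_derivative F' r) (at r)" if r: "r \<in> {0<..<1} - {1/2}" for r
      unfolding F_def F'_def has_real_derivative_iff_has_vector_derivative[symmetric]
      by (rule DERIV_mult[OF r_step_differentiated[OF V U step const(2) s r] dr_ds]) (use r in auto)
  qed auto
  then have "(F' has_integral 0) {0..1}"
    by (simp add: F_def flux_zero)
  from has_integral_neg[OF has_integral_mult_right[OF this, of \<Delta>t]]
  have "((\<lambda>r. - (\<Delta>t * F' r)) has_integral 0) {0..1}"
    by simp
  moreover have "- (\<Delta>t * F' r) \<le> 1/2 * (ds U (s, r))\<^sup>2 - 1/2 * (ds V (s, r))\<^sup>2" for r
  proof -
    have "0 \<le> \<Delta>t * (K * (ds (dr V) (s, r))\<^sup>2)"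
      using const by simp
    moreover have "\<Delta>t * F' r = (ds V (s, r) - ds U (s, r)) * ds V (s, r) + \<Delta>t * (K * (ds (dr V) (s, r))\<^sup>2)"
      using const by (simp add: F'_def power2_eq_square field_simps)
    ultimately show ?thesis
      using sum_squares_bound[of "ds U (s, r)" "ds V (s, r)"]
      by (simp add: power2_eq_square algebra_simps)
  qed
  ultimately show ?thesis
    unfolding has_nonneg_minorant_def by blast
qed

section \<open>The discrete energy\<close>

definition energy :: "real \<Rightarrow> real \<Rightarrow> (real \<times> real \<Rightarrow> real) \<Rightarrow> real" where
  "energy \<nu> \<Delta>t f = 1/2 * (LBINT p:Omega. (f p)\<^sup>2) + \<nu> * \<Delta>t / 2 * (LBINT p:Omega. (ds f p)\<^sup>2)"

lemma s_step_energy: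
  assumes T: "regular_in_s T" and U: "regular_in_s U"
    and step: "imex_step_s K \<gamma> \<nu> \<Delta>t T U"
    and const: "0 \<le> K" "0 \<le> \<gamma>" "0 < \<Delta>t"
    and bound: "\<And>r. r \<in> {0<..<1} \<Longrightarrow> K * sup_norm_s T r powr (5/2) \<le> \<nu>"
  shows "energy \<nu> \<Delta>t U \<le> energy \<nu> \<Delta>t T"
proof -
  note int = regular_in_s_square_integrable[OF T] regular_in_s_square_integrable[OF U]
  have "0 \<le> (LBINT p:Omega. (1/2 * (T p)\<^sup>2 + \<nu> * \<Delta>t / 2 * (ds T p)\<^sup>2)
      - (1/2 * (U p)\<^sup>2 + \<nu> * \<Delta>t / 2 * (ds U p)\<^sup>2))"
  proof (rule LBINT_Omega_nonneg_by_s_slices)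
    show "has_nonneg_minorant (\<lambda>s. (1/2 * (T (s, r))\<^sup>2 + \<nu> * \<Delta>t / 2 * (ds T (s, r))\<^sup>2)
      - (1/2 * (U (s, r))\<^sup>2 + \<nu> * \<Delta>t / 2 * (ds U (s, r))\<^sup>2))" if r: "r \<in> {0<..<1} - {1/2}" for r
      by (rule s_step_slice[OF T U step const r])
         (use r const(1) in \<open>auto intro!: coefficient_le_viscosity[OF T] bound\<close>)
  qed (intro set_integral_diff set_integral_add set_integrable_mult_right int)
  also have "\<dots> = energy \<nu> \<Delta>t T - energy \<nu> \<Delta>t U"
    unfolding energy_def
    by (simp add: set_integral_diff set_integral_add set_integrable_mult_right int)
  finally show ?thesis
    by simp
qed

lemma r_step_energy:
  assumes V: "regular_in_s_r V" and U: "regular_in_s U"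
    and step: "imex_step_r K Q \<Delta>t U V"
    and const: "0 \<le> K" "0 < \<Delta>t" "0 < \<nu>"
  shows "energy \<nu> \<Delta>t V \<le> energy \<nu> \<Delta>t U
    - K * \<Delta>t * ((LBINT p:Omega. (dr V p)\<^sup>2) - Q * (LBINT s:{0<..<1}. V (s, 0)))"
proof -
  note V_s = regular_in_s_r_imp_regular_in_s[OF V]
  note int = regular_in_s_square_integrable[OF U] regular_in_s_square_integrable[OF V_s]
  have int_dr: "set_integrable lborel Omega (\<lambda>p. (dr V p)\<^sup>2)"
    using V unfolding regular_in_s_r_def
    by (intro set_integrable_continuous_on_square continuous_intros) auto
  have "continuous_on ({0..1} \<times> {0..1}) (\<lambda>p :: real \<times> real. V (fst p, 0))"
    by (rule continuous_on_compose2[of "{0..1} \<times> {0..1}" V])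
       (use V in \<open>auto simp: regular_in_s_r_def intro!: continuous_intros\<close>)
  then have int_0: "set_integrable lborel Omega (\<lambda>p. V (fst p, 0))"
    by (rule set_integrable_continuous_on_square)
  \<comment> \<open>The unit interval has length 1, so integrating the trace in \<open>r\<close> changes nothing.\<close>
  have trace: "(LBINT p:Omega. V (fst p, 0)) = (LBINT s:{0<..<1}. V (s, 0))"
    by (simp add: LBINT_Omega_iterated(1)[OF int_0] set_integral_const)
  have "0 \<le> (LBINT p:Omega. 1/2 * (U p)\<^sup>2 - 1/2 * (V p)\<^sup>2
      - K * \<Delta>t * ((dr V p)\<^sup>2 - Q * V (fst p, 0)))"
    by (rule LBINT_Omega_nonneg_by_r_slices)
       (use r_step_slice[OF V U step const(2)] in
         \<open>auto intro!: set_integral_diff set_integrable_mult_right int int_dr int_0\<close>)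
  also have "\<dots> = 1/2 * (LBINT p:Omega. (U p)\<^sup>2) - 1/2 * (LBINT p:Omega. (V p)\<^sup>2)
      - K * \<Delta>t * ((LBINT p:Omega. (dr V p)\<^sup>2) - Q * (LBINT s:{0<..<1}. V (s, 0)))"
    by (simp add: set_integral_diff set_integrable_mult_right int int_dr int_0 trace)
  finally have value_part: "0 \<le> \<dots>" .
  have "0 \<le> (LBINT p:Omega. 1/2 * (ds U p)\<^sup>2 - 1/2 * (ds V p)\<^sup>2)"
    by (rule LBINT_Omega_nonneg_by_r_slices)
       (use r_step_slice_ds[OF V U step const(1,2)] in
         \<open>auto intro!: set_integral_diff set_integrable_mult_right int\<close>)
  also have "\<dots> = 1/2 * (LBINT p:Omega. (ds U p)\<^sup>2) - 1/2 * (LBINT p:Omega. (ds V p)\<^sup>2)"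
    by (simp add: set_integral_diff set_integrable_mult_right int)
  finally have "\<nu> * \<Delta>t / 2 * (LBINT p:Omega. (ds V p)\<^sup>2) \<le> \<nu> * \<Delta>t / 2 * (LBINT p:Omega. (ds U p)\<^sup>2)"
    using const by (intro mult_left_mono) auto
  with value_part show ?thesis
    unfolding energy_def by linarith
qed

theorem proposition3p1:
  fixes Kpar Kperp \<gamma> Qperp \<nu> \<Delta>t :: real
    and T Tstar :: "nat \<Rightarrow> real \<times> real \<Rightarrow> real"
  assumes "Kpar \<ge> 0" and "Kperp \<ge> 0" and "\<gamma> \<ge> 0" and "Qperp > 0" and "\<nu> > 0" and "\<Delta>t > 0"
    and "imex_scheme Kpar Kperp \<gamma> Qperp \<nu> \<Delta>t T Tstar"
    and "\<forall>r \<in> {0<..<1}. \<forall>n. Kpar * sup_norm_s (T n) r powr (5/2) \<le> \<nu>"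
  shows "\<forall>n.
    1/2 * (LBINT p:Omega. (T (n + 1) p)\<^sup>2)
      + \<nu> * \<Delta>t / 2 * (LBINT p:Omega. \<bar>ds (T (n + 1)) p\<bar>\<^sup>2)
    \<le> 1/2 * (LBINT p:Omega. (T 0 p)\<^sup>2)
      + \<nu> * \<Delta>t / 2 * (LBINT p:Omega. \<bar>ds (T 0) p\<bar>\<^sup>2)
      - Kperp * \<Delta>t * (\<Sum>k = 1..n + 1.
          (LBINT p:Omega. \<bar>dr (T k) p\<bar>\<^sup>2) - Qperp * (LBINT s:{0<..<1}. T k (s, 0)))"
proof -
  define D where "D k = (LBINT p:Omega. (dr (T k) p)\<^sup>2) - Qperp * (LBINT s:{0<..<1}. T k (s, 0))" for k
  have scheme: "regular_in_s (Tstar n)" "regular_in_s_r (T (Suc n))"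
      "imex_step_s Kpar \<gamma> \<nu> \<Delta>t (T n) (Tstar n)" "imex_step_r Kperp Qperp \<Delta>t (Tstar n) (T (Suc n))" for n
    using assms(7) unfolding imex_scheme_def by auto
  \<comment> \<open>The initial datum has regularity in \<open>s\<close> only, the later iterates in both variables.\<close>
  have regular: "regular_in_s (T n)" for n
    using assms(7) regular_in_s_r_imp_regular_in_s unfolding imex_scheme_def by (cases n) auto
  have one_step: "energy \<nu> \<Delta>t (T (Suc n)) \<le> energy \<nu> \<Delta>t (T n) - Kperp * \<Delta>t * D (Suc n)" for n
  proof -
    have "energy \<nu> \<Delta>t (Tstar n) \<le> energy \<nu> \<Delta>t (T n)"
      using assms by (intro s_step_energy[OF regular scheme(1,3)]) auto
    moreover have "energy \<nu> \<Delta>t (T (Suc n)) \<le> energy \<nu> \<Delta>t (Tstar n) - Kperp * \<Delta>t * D (Suc n)"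
      unfolding D_def using assms by (intro r_step_energy[OF scheme(2,1,4)]) auto
    ultimately show ?thesis
      by simp
  qed
  have "energy \<nu> \<Delta>t (T (n + 1)) \<le> energy \<nu> \<Delta>t (T 0) - Kperp * \<Delta>t * (\<Sum>k = 1..n + 1. D k)" for n
  proof (induction n)
    case 0
    show ?case
      using one_step[of 0] by simp
  next
    case (Suc n)
    then show ?case
      using one_step[of "Suc n"] by (simp add: algebra_simps)
  qed
  then show ?thesis
    by (simp add: energy_def D_def)
qed

end
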